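(* Let $N\geq 2$ and let $g=(g_{i,j})_{i,j=0}^{N-1}\in SL_N(L^\infty(\mathbb{T}))$, i.e. $g_{i,j}\in L^\infty(\mathbb{T})$ and $\det g\equiv 1$ on $\mathbb{T}$. Then for every factorization $$g(z)=\begin{pmatrix}1&0&0&\cdots&0\\ L_1(z)&1&0&\cdots&0\\ L_2(z)&0&1&\ddots&0\\ \vdots&\vdots&\ddots&\ddots&\vdots\\ L_{N-1}(z)&0&\cdots&0&1\end{pmatrix}g^{(new)}(z)$$ with $L_1,\dots,L_{N-1}\in L^\infty(\mathbb{T})$ and $g^{(new)}\in SL_N(L^\infty(\mathbb{T}))$, there are unique functions $f_i\in L^\infty(\mathbb{T})$, $i=1,\dots,N-1$, such that $$g^{(new)}_{0,j}=g_{0,j}\quad (0\le j\le N-1),\qquad\text{and}\qquad g^{(new)}_{i,j}=S_j^*f_i\quad (1\le i\le N-1,\ 0\le j\le N-1).$$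
   Context: $\mathbb{T}$ is the unit circle with normalized Haar measure; equalities of functions are a.e. The operators $S_j$, $j=0,\dots,N-1$, are the isometries on $L^2(\mathbb{T})$ given by $(S_j\psi)(z)=z^j\psi(z^N)$; they satisfy the Cuntz relations $S_i^*S_j=\delta_{i,j}I$, $\sum_{i}S_iS_i^*=I$, and their adjoints are $(S_j^*\psi)(z)=\frac1N\sum_{w\in\mathbb{T},\,w^N=z}\overline{w}^{\,j}\psi(w)$. The lower triangular factor in the claim has $1$'s on the diagonal, first column $(1,L_1,\dots,L_{N-1})^T$, and all other entries $0$. *)

theory Defs
  imports "HOL-Probability.Probability_Measure" "Jordan_Normal_Form.Determinant"
begin

text \<open>
  Elements of the spaces \<open>L\<^sup>p(\<T>)\<close> are represented by Borel functions \<open>complex \<Rightarrow> complex\<close>; only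
  their values on the unit circle matter, and two of them are identified when they agree
  almost everywhere with respect to \<open>circle\<close>.
\<close>

definition circle :: "complex measure" where
  "circle = distr (restrict_space lborel {0..<1}) (restrict_space borel (sphere 0 1))
              (\<lambda>t. cis (2 * pi * t))"

definition Linf :: "'a measure \<Rightarrow> ('a \<Rightarrow> complex) set" where
  "Linf M = {\<phi> \<in> borel_measurable M. \<exists>C. AE x in M. norm (\<phi> x) \<le> C}"

definition L2 :: "'a measure \<Rightarrow> ('a \<Rightarrow> complex) set" where
  "L2 M = {\<phi> \<in> borel_measurable M. integrable M (\<lambda>x. (norm (\<phi> x))\<^sup>2)}"

definition SL_Linf :: "nat \<Rightarrow> (complex \<Rightarrow> complex mat) set" where
  "SL_Linf N = {g. (\<forall>z \<in> sphere 0 1. g z \<in> carrier_mat N N) \<and>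
                   (\<forall>i<N. \<forall>j<N. (\<lambda>z. g z $$ (i, j)) \<in> Linf circle) \<and>
                   (AE z in circle. Determinant.det (g z) = 1)}"

definition lower_factor :: "nat \<Rightarrow> (nat \<Rightarrow> complex \<Rightarrow> complex) \<Rightarrow> complex \<Rightarrow> complex mat" where
  "lower_factor N L z =
     Matrix.mat N N (\<lambda>(i, j). if i = j then 1 else if j = 0 then L i z else 0)"

definition cuntz_S :: "nat \<Rightarrow> nat \<Rightarrow> (complex \<Rightarrow> complex) \<Rightarrow> complex \<Rightarrow> complex" where
  "cuntz_S N j \<psi> z = z ^ j * \<psi> (z ^ N)"

definition cuntz_S_adj :: "nat \<Rightarrow> nat \<Rightarrow> (complex \<Rightarrow> complex) \<Rightarrow> complex \<Rightarrow> complex" where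
  "cuntz_S_adj N j \<psi> z = (1 / of_nat N) * (\<Sum>w | w \<in> sphere 0 1 \<and> w ^ N = z. cnj w ^ j * \<psi> w)"

text \<open>
  Sanity checks for the definitions above: \<open>circle\<close> is a rotation invariant probability measure,
  i.e. the normalized Haar measure, and \<open>cuntz_S_adj N j\<close> is the Hilbert space adjoint of
  the isometry \<open>cuntz_S N j\<close> of \<open>L\<^sup>2(\<T>)\<close>.
\<close>

lemma measurable_cis [measurable]: "(\<lambda>t. cis (2 * pi * t)) \<in> borel_measurable borel"
  by (intro borel_measurable_continuous_onI continuous_intros)

lemma circle_param_measurable:
  "(\<lambda>t. cis (2 * pi * t)) \<in> restrict_space lborel {0..<1} \<rightarrow>\<^sub>M restrict_space borel (sphere 0 1)"
  by (intro measurable_restrict_space2 measurable_restrict_space1) (auto simp: measurable_lborel1)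

lemma space_circle: "space circle = sphere 0 1" and
  sets_circle: "sets circle = sets (restrict_space borel (sphere 0 1))"
  by (auto simp: circle_def space_restrict_space)

lemma measurable_circle: "measurable circle M = measurable (restrict_space borel (sphere 0 1)) M"
  by (intro measurable_cong_sets sets_circle refl)

lemma circle_comp_measurable:
  assumes "F \<in> measurable circle M"
  shows "(\<lambda>t. F (cis (2 * pi * t))) \<in> measurable borel M"
proof -
  have "(\<lambda>t. cis (2 * pi * t)) \<in> borel \<rightarrow>\<^sub>M restrict_space borel (sphere 0 1)"
    by (intro measurable_restrict_space2) auto
  from measurable_compose[OF this] assms show ?thesis unfolding measurable_circle by blast
qed

lemma nn_integral_circle:
  assumes "F \<in> borel_measurable circle"
  shows "(\<integral>\<^sup>+z. F z \<partial>circle) = (\<integral>\<^sup>+t. indicator {0..<1} t * F (cis (2 * pi * t)) \<partial>lborel)"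
  using assms circle_param_measurable unfolding circle_def measurable_circle
  by (subst nn_integral_distr) (auto simp: nn_integral_restrict_space mult.commute)

lemma integrable_circle:
  fixes F :: "complex \<Rightarrow> 'b::{banach, second_countable_topology}"
  assumes "F \<in> borel_measurable circle"
  shows "integrable circle F \<longleftrightarrow> integrable lborel (\<lambda>t. indicator {0..<1} t *\<^sub>R F (cis (2 * pi * t)))"
  using assms circle_param_measurable unfolding measurable_circle unfolding circle_def 
  by (subst integrable_distr_eq) (auto simp: integrable_restrict_space)

lemma integral_circle:
  fixes F :: "complex \<Rightarrow> 'b::{banach, second_countable_topology}"
  assumes "F \<in> borel_measurable circle"
  shows "(\<integral>z. F z \<partial>circle) = (\<integral>t. indicator {0..<1} t *\<^sub>R F (cis (2 * pi * t)) \<partial>lborel)"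
  using assms circle_param_measurable unfolding measurable_circle unfolding circle_def 
  by (subst integral_distr) (auto simp: integral_restrict_space)

lemma prob_space_circle: "prob_space circle"
proof (rule prob_spaceI)
  have "emeasure circle (space circle) = (\<integral>\<^sup>+z. 1 \<partial>circle)" by simp
  also have "\<dots> = 1" by (subst nn_integral_circle) auto
  finally show "emeasure circle (space circle) = 1" .
qed

lemma nn_integral_circle_rotate:
  assumes F: "F \<in> borel_measurable circle" and c: "norm c = 1"
  shows "(\<integral>\<^sup>+z. F (c * z) \<partial>circle) = (\<integral>\<^sup>+z. F z \<partial>circle)"
proof -
  define a where "a = Arg2pi c / (2 * pi)"
  have a: "0 \<le> a" "a < 1" using Arg2pi_ge_0[of c] Arg2pi_lt_2pi[of c] by (auto simp: a_def)
  have ca: "c = cis (2 * pi * a)" using c Arg2pi_eq[of c] by (simp add: a_def cis_conv_exp)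
  define G where "G t = F (cis (2 * pi * t))" for t
  have G [measurable]: "G \<in> borel_measurable borel"
    using circle_comp_measurable[OF F] by (simp add: G_def[abs_def])
  have G1: "G (1 + t) = G t" for t by (simp add: G_def ring_distribs flip: cis_mult)
  have m: "(\<lambda>z. F (c * z)) \<in> borel_measurable circle"
  proof -
    have "(\<lambda>z. c * z) \<in> circle \<rightarrow>\<^sub>M circle"
      unfolding measurable_circle measurable_cong_sets[OF refl sets_circle]
      by (intro measurable_restrict_space2 measurable_restrict_space1) (auto simp: space_restrict_space norm_mult c)
    from measurable_compose[OF this F] show ?thesis .
  qed
  have "(\<integral>\<^sup>+z. F (c * z) \<partial>circle) = (\<integral>\<^sup>+t. indicator {0..<1} t * G (a + t) \<partial>lborel)"
    unfolding nn_integral_circle[OF m] by (simp add: G_def ca ring_distribs cis_mult)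
  also have "\<dots> = (\<integral>\<^sup>+t. indicator {a..<1 + a} t * G t \<partial>lborel)"
    by (subst (2) nn_integral_real_affine[where t = a and c = 1]) (auto intro!: nn_integral_cong split: split_indicator)
  also have "\<dots> = (\<integral>\<^sup>+t. indicator {a..<1} t * G t + indicator {1..<1 + a} t * G t \<partial>lborel)"
    using a by (auto intro!: nn_integral_cong split: split_indicator)
  also have "\<dots> = (\<integral>\<^sup>+t. indicator {a..<1} t * G t \<partial>lborel) + (\<integral>\<^sup>+t. indicator {1..<1 + a} t * G t \<partial>lborel)"
    by (rule nn_integral_add) auto
  also have "(\<integral>\<^sup>+t. indicator {1..<1 + a} t * G t \<partial>lborel) = (\<integral>\<^sup>+t. indicator {0..<a} t * G t \<partial>lborel)"
    by (subst nn_integral_real_affine[where t = 1 and c = 1]) (auto intro!: nn_integral_cong simp: G1 split: split_indicator)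
  also have "(\<integral>\<^sup>+t. indicator {a..<1} t * G t \<partial>lborel) + (\<integral>\<^sup>+t. indicator {0..<a} t * G t \<partial>lborel)
     = (\<integral>\<^sup>+t. indicator {a..<1} t * G t + indicator {0..<a} t * G t \<partial>lborel)"
    by (rule nn_integral_add[symmetric]) auto
  also have "\<dots> = (\<integral>\<^sup>+t. indicator {0..<1} t * G t \<partial>lborel)"
    using a by (auto intro!: nn_integral_cong split: split_indicator)
  also have "\<dots> = (\<integral>\<^sup>+z. F z \<partial>circle)" by (simp add: nn_integral_circle[OF F] G_def)
  finally show ?thesis .
qed

lemma circle_rotate:
  assumes "norm c = 1"
  shows "distr circle circle (\<lambda>z. c * z) = circle"
proof (rule measure_eqI)
  have m: "(\<lambda>z. c * z) \<in> circle \<rightarrow>\<^sub>M circle"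
      unfolding measurable_circle measurable_cong_sets[OF refl sets_circle]
      by (intro measurable_restrict_space2 measurable_restrict_space1)
         (auto simp: space_restrict_space norm_mult assms)
  fix A assume "A \<in> sets (distr circle circle (\<lambda>z. c * z))"
  hence A: "A \<in> sets circle" by simp
  have "emeasure (distr circle circle (\<lambda>z. c * z)) A = (\<integral>\<^sup>+z. indicator A (c * z) \<partial>circle)"
    using A m by (simp add: nn_integral_distr flip: nn_integral_indicator)
  also have "\<dots> = emeasure circle A" using A assms by (subst nn_integral_circle_rotate) auto
  finally show "emeasure (distr circle circle (\<lambda>z. c * z)) A = emeasure circle A" .
qed simp

lemma bij_betw_circle_roots:
  assumes "N > 0"
  shows "bij_betw (\<lambda>k. cis (2 * pi * ((s + real k) / real N))) {..<N}
           {w. w \<in> sphere 0 1 \<and> w ^ N = cis (2 * pi * s)}"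
proof -
  let ?c = "cis (2 * pi * s / N)"
  have c: "?c ^ N = cis (2 * pi * s)" using assms by (simp add: Complex.DeMoivre)
  have "bij_betw (\<lambda>z. ?c * z) {z. z ^ N = 1} {w. w ^ N = cis (2 * pi * s)}"
    by (rule bij_betwI[where g = "\<lambda>z. z / ?c"])
       (auto simp: power_mult_distrib power_divide c)
  from bij_betw_trans[OF Complex.bij_betw_roots_unity[OF assms] this]
  have "bij_betw (\<lambda>k. cis (2 * pi * ((s + real k) / real N))) {..<N} {w. w ^ N = cis (2 * pi * s)}"
    by (simp add: o_def cis_mult add_divide_distrib ring_distribs)
  moreover have "norm w = 1" if "w ^ N = cis (2 * pi * s)" for w
  proof -
    have "norm w ^ N = 1" using that by (simp flip: norm_power)
    thus ?thesis using assms by (metis norm_ge_zero power_eq_1_iff not_gr_zero abs_of_nonneg real_norm_def)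
  qed
  hence "{w. w \<in> sphere 0 1 \<and> w ^ N = cis (2 * pi * s)} = {w. w ^ N = cis (2 * pi * s)}" by auto
  ultimately show ?thesis by simp
qed

lemma indicator_unit_split:
  assumes "N > 0"
  shows "indicator {0..<1} (t::real) = (\<Sum>k<N. indicator {0..<1} (real N * t - real k) :: 'a :: semiring_1)"
proof (cases "t \<in> {0..<1}")
  case True
  define m where "m = nat \<lfloor>real N * t\<rfloor>"
  have t0: "0 \<le> real N * t" "real N * t < real N" using True assms by auto
  have m: "real m \<le> real N * t" "real N * t < real m + 1" using t0 by (auto simp: m_def)
  have "m < N" using m t0 by linarith
  have "(\<Sum>k<N. indicator {0..<1} (real N * t - real k)) = (\<Sum>k<N. if k = m then 1 else 0 :: 'a)"
  proof (rule sum.cong)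
    fix k
    have "real N * t - real k \<in> {0..<1} \<longleftrightarrow> k = m" 
      using m by auto
    thus "indicator {0..<1} (real N * t - real k) = (if k = m then 1 else 0 :: 'a)" by (simp add: indicator_def)
  qed simp
  thus ?thesis using True \<open>m < N\<close> by simp
next
  case False
  have "real N * t - real k \<notin> {0..<1}" if "k < N" for k
  proof
    assume *: "real N * t - real k \<in> {0..<1}"
    have "real k + 1 \<le> real N" using that by linarith
    moreover have "0 \<le> real N * t - real k" "real N * t - real k < 1" using * by auto
    ultimately have "0 \<le> real N * t" "real N * t < real N * 1" by linarith+
    hence "t \<in> {0..<1}" using assms by (auto simp: zero_le_mult_iff mult_less_cancel_left)
    thus False using False by blast
  qed
  thus ?thesis using False by simp
qed


definition root_avg :: "nat \<Rightarrow> (complex \<Rightarrow> 'b) \<Rightarrow> complex \<Rightarrow> 'b :: comm_monoid_add" where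
  "root_avg N F z = (\<Sum>w | w \<in> sphere 0 1 \<and> w ^ N = z. F w)"

lemma root_avg_cis:
  assumes "N > 0"
  shows "root_avg N F (cis (2 * pi * s)) = (\<Sum>k<N. F (cis (2 * pi * ((s + real k) / real N))))"
  unfolding root_avg_def using sum.reindex_bij_betw[OF bij_betw_circle_roots[OF assms], of F s] by simp

lemma root_avg_measurable:
  fixes F :: "complex \<Rightarrow> 'b :: {second_countable_topology, topological_comm_monoid_add}"
  assumes N: "N > 0" and F: "F \<in> borel_measurable circle"
  shows "root_avg N F \<in> borel_measurable circle"
proof -
  define A where "A z = (if z \<in> - \<real>\<^sub>\<le>\<^sub>0 then Arg z else pi)" for z
  have [measurable]: "A \<in> borel_measurable borel"
    unfolding A_def[abs_def]
    by (intro borel_measurable_continuous_on_if continuous_on_Arg continuous_intros borel_open)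
       (auto simp: open_Compl)
  have G [measurable]: "(\<lambda>t. F (cis (2 * pi * t))) \<in> borel_measurable borel"
    by (rule circle_comp_measurable[OF F])
  have "(\<lambda>z. \<Sum>k<N. F (cis (2 * pi * ((A z / (2 * pi) + real k) / real N)))) \<in> borel_measurable borel"
    by (intro borel_measurable_sum measurable_compose[OF _ G]) measurable
  hence "(\<lambda>z. \<Sum>k<N. F (cis (2 * pi * ((A z / (2 * pi) + real k) / real N)))) \<in> borel_measurable circle"
    unfolding measurable_circle by (rule measurable_restrict_space1)
  moreover have "root_avg N F z = (\<Sum>k<N. F (cis (2 * pi * ((A z / (2 * pi) + real k) / real N))))"
    if "z \<in> space circle" for z
  proof -
    have z: "norm z = 1" "z \<noteq> 0" using that by (auto simp: space_circle)
    have "A z = Arg z"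
      using z by (auto simp: A_def complex_nonpos_Reals_iff Arg_eq_pi[of z] less_le complex_eq_iff intro!: Arg_eq_pi[THEN iffD2, symmetric])
    hence "cis (2 * pi * (A z / (2 * pi))) = z" using z by (simp add: cis_Arg sgn_div_norm)
    thus ?thesis using root_avg_cis[OF N, of F "A z / (2 * pi)"] by simp
  qed
  ultimately show ?thesis by (simp cong: measurable_cong)
qed

lemma nn_integral_circle_root_avg:
  assumes N: "N > 0" and F: "F \<in> borel_measurable circle"
  shows "(\<integral>\<^sup>+z. F z \<partial>circle) = ennreal (1 / real N) * (\<integral>\<^sup>+z. root_avg N F z \<partial>circle)"
proof -
  define G where "G t = F (cis (2 * pi * t))" for t
  have G [measurable]: "G \<in> borel_measurable borel"
    using circle_comp_measurable[OF F] by (simp add: G_def[abs_def])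
  have "(\<integral>\<^sup>+z. F z \<partial>circle) = (\<integral>\<^sup>+t. indicator {0..<1} t * G t \<partial>lborel)"
    by (simp add: nn_integral_circle[OF F] G_def)
  also have "\<dots> = (\<integral>\<^sup>+t. (\<Sum>k<N. indicator {0..<1} (real N * t - real k) * G t) \<partial>lborel)"
    by (intro nn_integral_cong, subst indicator_unit_split[OF N]) (rule sum_distrib_right)
  also have "\<dots> = (\<Sum>k<N. \<integral>\<^sup>+t. indicator {0..<1} (real N * t - real k) * G t \<partial>lborel)"
    by (rule nn_integral_sum) auto
  also have "\<dots> = (\<Sum>k<N. ennreal (1 / real N) *
                    (\<integral>\<^sup>+s. indicator {0..<1} s * G ((s + real k) / real N) \<partial>lborel))"
  proof (rule sum.cong)
    fix k
    show "(\<integral>\<^sup>+t. indicator {0..<1} (real N * t - real k) * G t \<partial>lborel) =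
       ennreal (1 / real N) * (\<integral>\<^sup>+s. indicator {0..<1} s * G ((s + real k) / real N) \<partial>lborel)"
      using N by (subst nn_integral_real_affine[where t = "real k / real N" and c = "1 / real N"])
         (auto simp: ring_distribs add_divide_distrib add.commute)
  qed simp
  also have "\<dots> = ennreal (1 / real N) *
               (\<integral>\<^sup>+s. (\<Sum>k<N. indicator {0..<1} s * G ((s + real k) / real N)) \<partial>lborel)"
    by (subst nn_integral_sum) (auto simp: sum_distrib_left)
  also have "\<dots> = ennreal (1 / real N) * (\<integral>\<^sup>+z. root_avg N F z \<partial>circle)"
    by (simp add: nn_integral_circle[OF root_avg_measurable[OF N F]] root_avg_cis[OF N]
                  G_def sum_distrib_left)
  finally show ?thesis .
qed

lemma integral_circle_root_avg:
  fixes F :: "complex \<Rightarrow> 'b :: {banach, second_countable_topology}"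
  assumes N: "N > 0" and int: "integrable circle F"
  shows "integrable circle (root_avg N F)"
    and "(\<integral>z. F z \<partial>circle) = (1 / real N) *\<^sub>R (\<integral>z. root_avg N F z \<partial>circle)"
proof -
  have F: "F \<in> borel_measurable circle" using int by auto
  define G where "G t = F (cis (2 * pi * t))" for t
  have G [measurable]: "G \<in> borel_measurable borel"
    using circle_comp_measurable[OF F] by (simp add: G_def[abs_def])
  have iG: "integrable lborel (\<lambda>t. indicator {0..<1} t *\<^sub>R G t)"
    using int by (simp add: integrable_circle[OF F] G_def)
  have i1: "integrable lborel (\<lambda>t. indicator {0..<1} (real N * t - real k) *\<^sub>R G t)" if "k < N" for k
  proof (rule Bochner_Integration.integrable_bound[OF iG])
    have "indicator {0..<1} (real N * t - real k) \<le> (indicator {0..<1} t :: real)" for t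
      unfolding indicator_unit_split[OF N, of t, where 'a = real]
      using that by (intro member_le_sum) auto
    thus "AE t in lborel. norm (indicator {0..<1} (real N * t - real k) *\<^sub>R G t)
        \<le> norm (indicator {0..<1} t *\<^sub>R G t)" by (auto intro!: mult_right_mono)
  qed auto
  have eq: "(\<lambda>s. indicator {0..<1} (real N * (real k / real N + 1 / real N * s) - real k) *\<^sub>R
                  G (real k / real N + 1 / real N * s)) =
            (\<lambda>s. indicator {0..<1} s *\<^sub>R G ((s + real k) / real N))" for k
    using N by (auto simp: ring_distribs add_divide_distrib add.commute)
  have i2: "integrable lborel (\<lambda>s. indicator {0..<1} s *\<^sub>R G ((s + real k) / real N))" if "k < N" for k
    using lborel_integrable_real_affine[OF i1[OF that], of "1 / real N" "real k / real N"] N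
    unfolding eq by simp
  have avg: "indicator {0..<1} s *\<^sub>R root_avg N F (cis (2 * pi * s)) =
        (\<Sum>k<N. indicator {0..<1} s *\<^sub>R G ((s + real k) / real N))" for s
    by (simp add: root_avg_cis[OF N] G_def scaleR_sum_right)
  show "integrable circle (root_avg N F)"
    unfolding integrable_circle[OF root_avg_measurable[OF N F]] avg
    using i2 by (intro Bochner_Integration.integrable_sum) auto
  have "(\<integral>z. F z \<partial>circle) = (\<integral>t. indicator {0..<1} t *\<^sub>R G t \<partial>lborel)"
    by (simp add: integral_circle[OF F] G_def)
  also have "\<dots> = (\<integral>t. (\<Sum>k<N. indicator {0..<1} (real N * t - real k) *\<^sub>R G t) \<partial>lborel)"
    by (intro Bochner_Integration.integral_cong refl, subst indicator_unit_split[OF N]) (rule scaleR_sum_left)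
  also have "\<dots> = (\<Sum>k<N. \<integral>t. indicator {0..<1} (real N * t - real k) *\<^sub>R G t \<partial>lborel)"
    using i1 by (intro Bochner_Integration.integral_sum) auto
  also have "\<dots> = (\<Sum>k<N. (1 / real N) *\<^sub>R (\<integral>s. indicator {0..<1} s *\<^sub>R G ((s + real k) / real N) \<partial>lborel))"
  proof (rule sum.cong)
    fix k
    show "(\<integral>t. indicator {0..<1} (real N * t - real k) *\<^sub>R G t \<partial>lborel) =
       (1 / real N) *\<^sub>R (\<integral>s. indicator {0..<1} s *\<^sub>R G ((s + real k) / real N) \<partial>lborel)"
      using N lborel_integral_real_affine[of "1 / real N"
          "\<lambda>t. indicator {0..<1} (real N * t - real k) *\<^sub>R G t" "real k / real N"]
      unfolding eq by simp
  qed simp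
  also have "\<dots> = (1 / real N) *\<^sub>R (\<integral>s. (\<Sum>k<N. indicator {0..<1} s *\<^sub>R G ((s + real k) / real N)) \<partial>lborel)"
    using i2 by (subst Bochner_Integration.integral_sum) (auto simp: scaleR_sum_right)
  also have "\<dots> = (1 / real N) *\<^sub>R (\<integral>z. root_avg N F z \<partial>circle)"
    unfolding integral_circle[OF root_avg_measurable[OF N F]] avg ..
  finally show "(\<integral>z. F z \<partial>circle) = (1 / real N) *\<^sub>R (\<integral>z. root_avg N F z \<partial>circle)" .
qed

lemma card_circle_roots:
  fixes z :: complex
  assumes "N > 0" "norm z = 1"
  shows "card {w. w \<in> sphere 0 1 \<and> w ^ N = z} = N"
proof -
  have "z = cis (2 * pi * (Arg2pi z / (2 * pi)))" using assms Arg2pi_eq[of z] by (simp add: cis_conv_exp)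
  thus ?thesis using bij_betw_same_card[OF bij_betw_circle_roots[OF assms(1), of "Arg2pi z / (2 * pi)"]] by simp
qed

lemma measurable_circle_power: "(\<lambda>z. z ^ N) \<in> circle \<rightarrow>\<^sub>M circle"
  unfolding measurable_circle measurable_cong_sets[OF refl sets_circle]
  by (intro measurable_restrict_space2 measurable_restrict_space1)
     (auto simp: space_restrict_space norm_power)

lemma cuntz_S_isometry:
  assumes N: "N > 0" and \<phi>: "\<phi> \<in> L2 circle"
  shows "cuntz_S N j \<phi> \<in> L2 circle"
    and "(\<integral>z. (norm (cuntz_S N j \<phi> z))\<^sup>2 \<partial>circle) = (\<integral>z. (norm (\<phi> z))\<^sup>2 \<partial>circle)"
proof -
  have m: "\<phi> \<in> borel_measurable circle" using \<phi> by (simp add: L2_def)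
  have mS: "cuntz_S N j \<phi> \<in> borel_measurable circle"
  proof -
    have "(\<lambda>z. z ^ j) \<in> borel_measurable circle"
      unfolding measurable_circle by (rule measurable_restrict_space1) auto
    thus ?thesis using measurable_compose[OF measurable_circle_power m]
      unfolding cuntz_S_def[abs_def] by (intro borel_measurable_times)
  qed
  have "(\<integral>\<^sup>+z. ennreal ((norm (cuntz_S N j \<phi> z))\<^sup>2) \<partial>circle) =
         ennreal (1 / real N) * (\<integral>\<^sup>+z. root_avg N (\<lambda>z. ennreal ((norm (cuntz_S N j \<phi> z))\<^sup>2)) z \<partial>circle)"
    using mS by (intro nn_integral_circle_root_avg N) auto
  also have "(\<integral>\<^sup>+z. root_avg N (\<lambda>z. ennreal ((norm (cuntz_S N j \<phi> z))\<^sup>2)) z \<partial>circle) =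
     (\<integral>\<^sup>+z. ennreal (real N) * ennreal ((norm (\<phi> z))\<^sup>2) \<partial>circle)"
  proof (rule nn_integral_cong)
    fix z assume "z \<in> space circle"
    hence z: "norm z = 1" by (simp add: space_circle)
    have "root_avg N (\<lambda>z. ennreal ((norm (cuntz_S N j \<phi> z))\<^sup>2)) z = 
      (\<Sum>w | w \<in> sphere 0 1 \<and> w ^ N = z. ennreal ((norm (\<phi> z))\<^sup>2))"
      unfolding root_avg_def by (rule sum.cong) (auto simp: cuntz_S_def norm_mult norm_power)
    thus "root_avg N (\<lambda>z. ennreal ((norm (cuntz_S N j \<phi> z))\<^sup>2)) z = ennreal (real N) * ennreal ((norm (\<phi> z))\<^sup>2)"
      using card_circle_roots[OF N z] by (simp add: ennreal_of_nat_eq_real_of_nat)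
  qed
  also have "\<dots> = ennreal (real N) * (\<integral>\<^sup>+z. ennreal ((norm (\<phi> z))\<^sup>2) \<partial>circle)"
    using m by (intro nn_integral_cmult) auto
  finally have eq: "(\<integral>\<^sup>+z. ennreal ((norm (cuntz_S N j \<phi> z))\<^sup>2) \<partial>circle) = (\<integral>\<^sup>+z. ennreal ((norm (\<phi> z))\<^sup>2) \<partial>circle)"
    using N by (simp flip: mult.assoc ennreal_mult)
  show "cuntz_S N j \<phi> \<in> L2 circle"
    using \<phi> eq mS unfolding L2_def by (auto simp: integrable_iff_bounded)
  show "(\<integral>z. (norm (cuntz_S N j \<phi> z))\<^sup>2 \<partial>circle) = (\<integral>z. (norm (\<phi> z))\<^sup>2 \<partial>circle)"
    using mS m by (simp add: integral_eq_nn_integral eq)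
qed

lemma cuntz_S_adj_L2:
  assumes N: "N > 0" and \<psi>: "\<psi> \<in> L2 circle"
  shows "cuntz_S_adj N j \<psi> \<in> L2 circle"
proof -
  have m: "\<psi> \<in> borel_measurable circle" and i: "integrable circle (\<lambda>z. (norm (\<psi> z))\<^sup>2)"
    using \<psi> by (auto simp: L2_def)
  have eq: "cuntz_S_adj N j \<psi> = (\<lambda>z. (1 / of_nat N) * root_avg N (\<lambda>w. cnj w ^ j * \<psi> w) z)"
    by (simp add: cuntz_S_adj_def root_avg_def fun_eq_iff)
  have "(\<lambda>w. cnj w ^ j) \<in> borel_measurable circle"
    unfolding measurable_circle
    by (intro measurable_restrict_space1 borel_measurable_continuous_onI continuous_intros)
  hence "(\<lambda>w. cnj w ^ j * \<psi> w) \<in> borel_measurable circle" using m by (rule borel_measurable_times)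
  from root_avg_measurable[OF N this] have mA: "cuntz_S_adj N j \<psi> \<in> borel_measurable circle"
    unfolding eq by (intro borel_measurable_times) auto
  have le: "(norm (cuntz_S_adj N j \<psi> z))\<^sup>2 \<le> root_avg N (\<lambda>w. (norm (\<psi> w))\<^sup>2) z" if z: "norm z = 1" for z
  proof -
    let ?R = "{w. w \<in> sphere 0 1 \<and> w ^ N = z}"
    have "norm (cuntz_S_adj N j \<psi> z) \<le> (1 / real N) * (\<Sum>w\<in>?R. norm (\<psi> w))"
      unfolding cuntz_S_adj_def norm_mult
      by (intro mult_mono order.trans[OF norm_sum] sum_mono) (auto simp: norm_divide norm_mult norm_power)
    hence "(norm (cuntz_S_adj N j \<psi> z))\<^sup>2 \<le> ((1 / real N) * (\<Sum>w\<in>?R. norm (\<psi> w)))\<^sup>2"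
      by (intro power_mono) auto
    also have "\<dots> \<le> (1 / real N)\<^sup>2 * (real (card ?R) * (\<Sum>w\<in>?R. (norm (\<psi> w))\<^sup>2))"
      unfolding power_mult_distrib
      using Cauchy_Schwarz_ineq_sum[of "\<lambda>_. 1" "\<lambda>w. norm (\<psi> w)" ?R]
      by (intro mult_left_mono) auto
    also have "\<dots> = (1 / real N) * (\<Sum>w\<in>?R. (norm (\<psi> w))\<^sup>2)"
      unfolding card_circle_roots[OF N z] using N by (simp add: power2_eq_square)
    also have "\<dots> \<le> 1 * (\<Sum>w\<in>?R. (norm (\<psi> w))\<^sup>2)"
      using N by (intro mult_right_mono sum_nonneg) auto
    finally show ?thesis by (simp add: root_avg_def)
  qed
  have "integrable circle (\<lambda>z. (norm (cuntz_S_adj N j \<psi> z))\<^sup>2)"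
  proof (rule Bochner_Integration.integrable_bound[OF integral_circle_root_avg(1)[OF N i]])
    show "AE z in circle. norm ((norm (cuntz_S_adj N j \<psi> z))\<^sup>2) \<le> norm (root_avg N (\<lambda>w. (norm (\<psi> w))\<^sup>2) z)"
      using le by (intro AE_I2) (auto simp: space_circle intro: order.trans[OF _ abs_ge_self])
  qed (use mA in auto)
  thus ?thesis using mA by (simp add: L2_def)
qed

lemma cuntz_S_adj_adjoint:
  assumes N: "N > 0" and \<phi>: "\<phi> \<in> L2 circle" and \<psi>: "\<psi> \<in> L2 circle"
  shows "(\<integral>z. cuntz_S N j \<phi> z * cnj (\<psi> z) \<partial>circle) = (\<integral>z. \<phi> z * cnj (cuntz_S_adj N j \<psi> z) \<partial>circle)"
proof -
  have S: "cuntz_S N j \<phi> \<in> L2 circle" by (rule cuntz_S_isometry[OF N \<phi>])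
  have cnj: "(\<lambda>z. cnj (\<psi> z)) \<in> borel_measurable circle"
    using \<psi> by (intro borel_measurable_continuous_on[of cnj \<psi>] continuous_intros) (auto simp: L2_def)
  have "integrable circle (\<lambda>z. cuntz_S N j \<phi> z * cnj (\<psi> z))"
  proof (rule Bochner_Integration.integrable_bound)
    show "integrable circle (\<lambda>z. (norm (cuntz_S N j \<phi> z))\<^sup>2 + (norm (\<psi> z))\<^sup>2)"
      using S \<psi> by (auto simp: L2_def)
    have "x * y \<le> x\<^sup>2 + y\<^sup>2" if "x \<ge> 0" "y \<ge> 0" for x y :: real
      using sum_squares_bound[of x y] mult_nonneg_nonneg[OF that] by linarith
    thus "AE z in circle. norm (cuntz_S N j \<phi> z * cnj (\<psi> z)) \<le> norm ((norm (cuntz_S N j \<phi> z))\<^sup>2 + (norm (\<psi> z))\<^sup>2)"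
      by (auto simp: norm_mult)
  qed (use S cnj in \<open>auto simp: L2_def intro!: borel_measurable_times\<close>)
  from integral_circle_root_avg(2)[OF N this]
  have "(\<integral>z. cuntz_S N j \<phi> z * cnj (\<psi> z) \<partial>circle) =
        (\<integral>z. (1 / real N) *\<^sub>R root_avg N (\<lambda>z. cuntz_S N j \<phi> z * cnj (\<psi> z)) z \<partial>circle)" by simp
  also have "\<dots> = (\<integral>z. \<phi> z * cnj (cuntz_S_adj N j \<psi> z) \<partial>circle)"
  proof (rule Bochner_Integration.integral_cong)
    fix z
    have "root_avg N (\<lambda>z. cuntz_S N j \<phi> z * cnj (\<psi> z)) z =
       (\<Sum>w | w \<in> sphere 0 1 \<and> w ^ N = z. \<phi> z * cnj (cnj w ^ j * \<psi> w))"
      unfolding root_avg_def by (rule sum.cong) (auto simp: cuntz_S_def)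
    thus "(1 / real N) *\<^sub>R root_avg N (\<lambda>z. cuntz_S N j \<phi> z * cnj (\<psi> z)) z = \<phi> z * cnj (cuntz_S_adj N j \<psi> z)"
      by (simp add: cuntz_S_adj_def scaleR_conv_of_real sum_distrib_left mult_ac)
  qed simp
  finally show ?thesis .
qed

end

theory Submission
  imports Defs
begin

text \<open>
  Write \<open>S\<^sub>j\<close> for \<open>cuntz_S N j\<close> and \<open>S\<^sub>j\<^sup>*\<close> for \<open>cuntz_S_adj N j\<close>. The Cuntz relations say that
  \<open>\<psi> \<mapsto> (S\<^sub>0\<^sup>* \<psi>, \<dots>, S\<^bsub>N-1\<^esub>\<^sup>* \<psi>)\<close> is a bijection whose inverse is
  \<open>(\<phi>\<^sub>0, \<dots>, \<phi>\<^bsub>N-1\<^esub>) \<mapsto> \<Sum>\<^sub>j S\<^sub>j \<phi>\<^sub>j\<close>. Hence every row of a matrix function is the sequence of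
  components \<open>S\<^sub>j\<^sup>* f\<close> of exactly one function \<open>f\<close>, namely
  \<open>f z = \<Sum>\<^sub>j z\<^sup>j \<phi>\<^sub>j (z\<^sup>N)\<close>, and \<open>f\<close> is essentially bounded when the entries are. The zeroth row
  of \<open>g_new\<close> equals that of \<open>g\<close> almost everywhere because the zeroth row of the lower triangular factor is
  \<open>(1, 0, \<dots>, 0)\<close>.

  Both relations hold at every point of the circle and amount to orthogonality of the characters
  \<open>w \<mapsto> w\<^sup>j\<close>: summing over the \<open>N\<close>-th roots of a point gives \<open>S\<^sub>j\<^sup>* S\<^sub>k = \<delta>\<^sub>j\<^sub>k\<close>
  (lemma \<open>cuntz_S_adj_sum_cuntz_S\<close>), summing over \<open>j\<close> gives \<open>\<Sum>\<^sub>j S\<^sub>j S\<^sub>j\<^sup>* = 1\<close>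
  (lemma \<open>sum_cuntz_S_cuntz_S_adj\<close>). The measure enters only in passing from functions to classes
  of functions: \<open>S\<^sub>j\<close> respects equality almost everywhere because preimages of null sets under
  \<open>z \<mapsto> z\<^sup>N\<close> are null (lemma \<open>AE_circle_power\<close>).
\<close>

section \<open>The Cuntz relations on the circle\<close>

text \<open>
  Multiplication by the primitive root of unity \<open>\<zeta>\<close> permutes the \<open>N\<close>-th roots of \<open>z\<close> and
  multiplies the summand by \<open>\<zeta>\<^bsup>k-j\<^esup>\<close>. As \<open>j, k < N\<close>, this factor differs from 1 when
  \<open>j \<noteq> k\<close>, and then the sum must vanish.
\<close>

lemma sum_circle_roots_orthogonal:
  fixes z :: complex
  assumes "j < N" "k < N" "norm z = 1"
  shows "(\<Sum>w | w \<in> sphere 0 1 \<and> w ^ N = z. cnj w ^ j * w ^ k) = (if j = k then of_nat N else 0)"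
proof -
  have N: "N > 0" using assms by simp
  let ?R = "{w. w \<in> sphere 0 1 \<and> w ^ N = z}"
  have unit: "cnj w ^ m * w ^ m = 1" if "norm w = 1" for w :: complex and m
    using that by (simp add: mult.commute[of "cnj w"] complex_norm_square[symmetric]
      flip: power_mult_distrib)
  show ?thesis
  proof (cases "j = k")
    case True
    have "(\<Sum>w\<in>?R. cnj w ^ j * w ^ k) = (\<Sum>w\<in>?R. 1)"
      by (rule sum.cong) (auto simp: True unit)
    then show ?thesis using card_circle_roots[OF N assms(3)] True by simp
  next
    case False
    define \<zeta> where "\<zeta> = cis (2 * pi / real N)"
    define T where "T = (\<Sum>w\<in>?R. cnj w ^ j * w ^ k)"
    have pow: "\<zeta> ^ m = cis (2 * pi * real m / real N)" for m
      by (simp add: \<zeta>_def Complex.DeMoivre mult.commute)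
    have \<zeta>N: "\<zeta> ^ N = 1" using N by (simp add: pow)
    have n\<zeta>: "norm \<zeta> = 1" by (simp add: \<zeta>_def)
    have \<zeta>0: "\<zeta> \<noteq> 0" using n\<zeta> by auto
    have bij: "bij_betw (\<lambda>w. \<zeta> * w) ?R ?R"
      by (rule bij_betwI[where g = "\<lambda>w. w / \<zeta>"])
         (auto simp: power_mult_distrib power_divide \<zeta>N norm_mult norm_divide n\<zeta> \<zeta>0)
    have "T = (\<Sum>w\<in>?R. cnj (\<zeta> * w) ^ j * (\<zeta> * w) ^ k)"
      unfolding T_def using sum.reindex_bij_betw[OF bij, of "\<lambda>w. cnj w ^ j * w ^ k"] by simp
    also have "\<dots> = (cnj \<zeta> ^ j * \<zeta> ^ k) * T"
      unfolding T_def sum_distrib_left by (rule sum.cong) (auto simp: power_mult_distrib)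
    finally have T: "T = (cnj \<zeta> ^ j * \<zeta> ^ k) * T" .
    have "cnj \<zeta> ^ j * \<zeta> ^ k \<noteq> 1"
    proof
      assume "cnj \<zeta> ^ j * \<zeta> ^ k = 1"
      then have "(cnj \<zeta> ^ j * \<zeta> ^ j) * \<zeta> ^ k = \<zeta> ^ j" by (simp add: algebra_simps)
      then have "\<zeta> ^ k = \<zeta> ^ j" by (simp add: unit n\<zeta>)
      then show False
        using bij_betw_imp_inj_on[OF Complex.bij_betw_roots_unity[OF N]] assms False
        by (auto simp: pow inj_on_def)
    qed
    then have "T = 0" using T by (metis mult_cancel_right1)
    then show ?thesis using False by (simp add: T_def)
  qed
qed

lemma cuntz_S_adj_sum_cuntz_S:
  assumes "j < N" "norm z = 1"
  shows "cuntz_S_adj N j (\<lambda>w. \<Sum>k<N. cuntz_S N k (\<phi> k) w) z = \<phi> j z"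
proof -
  let ?R = "{w. w \<in> sphere 0 1 \<and> w ^ N = z}"
  have "(\<Sum>w\<in>?R. cnj w ^ j * (\<Sum>k<N. cuntz_S N k (\<phi> k) w)) =
        (\<Sum>w\<in>?R. \<Sum>k<N. \<phi> k z * (cnj w ^ j * w ^ k))"
    by (rule sum.cong) (auto simp: cuntz_S_def sum_distrib_left mult_ac intro!: sum.cong)
  also have "\<dots> = (\<Sum>k<N. \<phi> k z * (\<Sum>w\<in>?R. cnj w ^ j * w ^ k))"
    by (subst sum.swap) (simp add: sum_distrib_left)
  also have "\<dots> = (\<Sum>k<N. if j = k then \<phi> k z * of_nat N else 0)"
    using assms by (intro sum.cong refl, subst sum_circle_roots_orthogonal) auto
  also have "\<dots> = \<phi> j z * of_nat N" using assms by simp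
  finally show ?thesis using assms by (simp add: cuntz_S_adj_def)
qed

text \<open>
  If \<open>w\<^sup>N = z\<^sup>N\<close>, then \<open>z * cnj w\<close> is an \<open>N\<close>-th root of unity, and the geometric sum of its powers
  vanishes unless \<open>w = z\<close>. So only the value of \<open>\<psi>\<close> at \<open>z\<close> itself survives.
\<close>

lemma sum_cuntz_S_cuntz_S_adj:
  assumes "N > 0" "norm z = 1"
  shows "(\<Sum>j<N. cuntz_S N j (cuntz_S_adj N j \<psi>) z) = \<psi> z"
proof -
  let ?R = "{w. w \<in> sphere 0 1 \<and> w ^ N = z ^ N}"
  have zN: "norm (z ^ N) = 1" using assms by (simp add: norm_power)
  have fin: "finite ?R"
    using card_circle_roots[OF assms(1) zN] assms(1) by (intro card_ge_0_finite) simp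
  have geo: "(\<Sum>j<N. (z * cnj w) ^ j) = (if w = z then of_nat N else 0)" if w: "w \<in> ?R" for w
  proof -
    have ww: "w * cnj w = 1" using w by (simp add: complex_norm_square[symmetric])
    have "(z * cnj w) ^ N = (w * cnj w) ^ N" using w by (simp add: power_mult_distrib)
    then have one: "(z * cnj w) ^ N = 1" by (simp add: ww)
    have iff: "z * cnj w = 1 \<longleftrightarrow> w = z"
      using ww by (metis mult.assoc mult.commute mult_1)
    show ?thesis
    proof (cases "w = z")
      case True
      then show ?thesis using ww by simp
    next
      case False
      then show ?thesis using iff one by (simp add: sum_gp_strict)
    qed
  qed
  have "(\<Sum>j<N. cuntz_S N j (cuntz_S_adj N j \<psi>) z) =
        (\<Sum>j<N. \<Sum>w\<in>?R. \<psi> w / of_nat N * (z * cnj w) ^ j)"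
    unfolding cuntz_S_def cuntz_S_adj_def
    by (simp add: sum_distrib_left power_mult_distrib mult_ac)
  also have "\<dots> = (\<Sum>w\<in>?R. \<psi> w / of_nat N * (\<Sum>j<N. (z * cnj w) ^ j))"
    by (subst sum.swap) (simp add: sum_distrib_left)
  also have "\<dots> = (\<Sum>w\<in>?R. if w = z then \<psi> w else 0)"
    using assms by (intro sum.cong refl, subst geo) auto
  also have "\<dots> = \<psi> z" using fin assms by simp
  finally show ?thesis .
qed

section \<open>Essentially bounded functions and the power map\<close>

text \<open>
  The mean of \<open>w \<mapsto> F (w\<^sup>N)\<close> over the \<open>N\<close>-th roots of \<open>z\<close> is \<open>F z\<close>, so the power map preserves
  the Haar measure.
\<close>

lemma nn_integral_circle_power:
  assumes N: "N > 0" and F: "F \<in> borel_measurable circle"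
  shows "(\<integral>\<^sup>+z. F (z ^ N) \<partial>circle) = (\<integral>\<^sup>+z. F z \<partial>circle)"
proof -
  have "(\<integral>\<^sup>+z. F (z ^ N) \<partial>circle) =
        ennreal (1 / real N) * (\<integral>\<^sup>+z. root_avg N (\<lambda>w. F (w ^ N)) z \<partial>circle)"
    by (rule nn_integral_circle_root_avg[OF N measurable_compose[OF measurable_circle_power F]])
  also have "(\<integral>\<^sup>+z. root_avg N (\<lambda>w. F (w ^ N)) z \<partial>circle) = (\<integral>\<^sup>+z. ennreal (real N) * F z \<partial>circle)"
  proof (rule nn_integral_cong)
    fix z assume "z \<in> space circle"
    then have z: "norm z = 1" by (simp add: space_circle)
    have "root_avg N (\<lambda>w. F (w ^ N)) z = (\<Sum>w | w \<in> sphere 0 1 \<and> w ^ N = z. F z)"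
      unfolding root_avg_def by (rule sum.cong) auto
    then show "root_avg N (\<lambda>w. F (w ^ N)) z = ennreal (real N) * F z"
      using card_circle_roots[OF N z] by (simp add: ennreal_of_nat_eq_real_of_nat)
  qed
  also have "\<dots> = ennreal (real N) * (\<integral>\<^sup>+z. F z \<partial>circle)"
    using F by (rule nn_integral_cmult)
  finally show ?thesis using N by (simp flip: mult.assoc ennreal_mult)
qed

lemma AE_circle_power:
  assumes N: "N > 0" and P: "AE z in circle. P z"
  shows "AE z in circle. P (z ^ N)"
proof -
  have "distr circle circle (\<lambda>z. z ^ N) = circle"
  proof (rule measure_eqI)
    fix B assume "B \<in> sets (distr circle circle (\<lambda>z. z ^ N))"
    then have B: "B \<in> sets circle" by simp
    have "emeasure (distr circle circle (\<lambda>z. z ^ N)) B = (\<integral>\<^sup>+z. indicator B (z ^ N) \<partial>circle)"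
      using B measurable_circle_power by (simp add: nn_integral_distr flip: nn_integral_indicator)
    also have "\<dots> = emeasure circle B" using B by (subst nn_integral_circle_power[OF N]) auto
    finally show "emeasure (distr circle circle (\<lambda>z. z ^ N)) B = emeasure circle B" .
  qed simp
  then have "AE z in distr circle circle (\<lambda>z. z ^ N). P z" using P by (simp only:)
  then show ?thesis by (rule AE_distrD[OF measurable_circle_power])
qed

lemma cuntz_S_Linf:
  assumes N: "N > 0" and \<phi>: "\<phi> \<in> Linf circle"
  shows "cuntz_S N j \<phi> \<in> Linf circle"
proof -
  have m: "\<phi> \<in> borel_measurable circle" using \<phi> by (simp add: Linf_def)
  obtain C where C: "AE z in circle. norm (\<phi> z) \<le> C" using \<phi> by (auto simp: Linf_def)
  have "(\<lambda>z. z ^ j) \<in> borel_measurable circle"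
    unfolding measurable_circle by (rule measurable_restrict_space1) auto
  then have "cuntz_S N j \<phi> \<in> borel_measurable circle"
    using measurable_compose[OF measurable_circle_power m]
    unfolding cuntz_S_def[abs_def] by (intro borel_measurable_times)
  moreover have "AE z in circle. norm (cuntz_S N j \<phi> z) \<le> C"
    using AE_circle_power[OF N C] AE_space
    by eventually_elim (simp add: cuntz_S_def norm_mult norm_power space_circle)
  ultimately show ?thesis by (auto simp: Linf_def)
qed

lemma Linf_sum:
  assumes "\<And>k. k \<in> I \<Longrightarrow> \<phi> k \<in> Linf M"
  shows "(\<lambda>x. \<Sum>k\<in>I. \<phi> k x) \<in> Linf M"
proof (cases "finite I")
  case True
  have "\<forall>k\<in>I. \<exists>C. AE x in M. norm (\<phi> k x) \<le> C" using assms by (auto simp: Linf_def)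
  then obtain C where C: "\<forall>k\<in>I. AE x in M. norm (\<phi> k x) \<le> C k" by metis
  then have "AE x in M. \<forall>k\<in>I. norm (\<phi> k x) \<le> C k" using True by (simp add: AE_finite_all)
  then have "AE x in M. norm (\<Sum>k\<in>I. \<phi> k x) \<le> (\<Sum>k\<in>I. C k)"
    by eventually_elim (auto intro: sum_norm_le)
  moreover have "(\<lambda>x. \<Sum>k\<in>I. \<phi> k x) \<in> borel_measurable M"
    using assms by (intro borel_measurable_sum) (auto simp: Linf_def)
  ultimately show ?thesis by (auto simp: Linf_def)
qed (auto simp: Linf_def intro: exI[of _ 0])

text \<open>
  Both functions are recovered from their components by \<open>\<Sum>\<^sub>j S\<^sub>j S\<^sub>j\<^sup>* = 1\<close>. At \<open>z\<close> this formula
  uses the components at \<open>z\<^sup>N\<close>, so the exceptional set is the preimage of a null set under the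
  power map.
\<close>

lemma AE_eq_if_cuntz_S_adj_eq:
  assumes N: "N > 0"
    and eq: "\<And>j. j < N \<Longrightarrow> AE z in circle. cuntz_S_adj N j h z = cuntz_S_adj N j f z"
  shows "AE z in circle. h z = f z"
proof -
  have "AE z in circle. \<forall>j\<in>{..<N}. cuntz_S_adj N j h z = cuntz_S_adj N j f z"
    using eq by (subst AE_finite_all) auto
  from AE_circle_power[OF N this] AE_space show ?thesis
  proof eventually_elim
    case (elim z)
    then have z: "norm z = 1" by (simp add: space_circle)
    have "h z = (\<Sum>j<N. cuntz_S N j (cuntz_S_adj N j h) z)"
      by (rule sum_cuntz_S_cuntz_S_adj[OF N z, symmetric])
    also have "\<dots> = (\<Sum>j<N. cuntz_S N j (cuntz_S_adj N j f) z)"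
      using elim(1) by (intro sum.cong) (auto simp: cuntz_S_def)
    also have "\<dots> = f z" by (rule sum_cuntz_S_cuntz_S_adj[OF N z])
    finally show ?case .
  qed
qed

section \<open>Factorizations with a lower triangular factor\<close>

lemma lower_factor_mult_row_0:
  assumes "A \<in> carrier_mat N N" "j < N"
  shows "(lower_factor N L z * A) $$ (0, j) = A $$ (0, j)"
proof -
  have "(lower_factor N L z * A) $$ (0, j) =
        (\<Sum>k\<in>{0..<N}. (if k = 0 then 1 else 0) * A $$ (k, j))"
    using assms by (auto simp: lower_factor_def scalar_prod_def intro!: sum.cong)
  also have "\<dots> = (\<Sum>k\<in>{0..<N}. if k = 0 then A $$ (k, j) else 0)"
    by (intro sum.cong) auto
  also have "\<dots> = A $$ (0, j)" using assms by simp
  finally show ?thesis .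
qed

theorem theorem3p12:
  fixes N :: nat
    and g g_new :: "complex \<Rightarrow> complex mat"
    and L :: "nat \<Rightarrow> complex \<Rightarrow> complex"
  assumes "N \<ge> 2"
    and "g \<in> SL_Linf N"
    and "\<forall>i \<in> {1..<N}. L i \<in> Linf circle"
    and "g_new \<in> SL_Linf N"
    and "AE z in circle. g z = lower_factor N L z * g_new z"
  shows "\<exists>f :: nat \<Rightarrow> complex \<Rightarrow> complex.
           (\<forall>i \<in> {1..<N}. f i \<in> Linf circle) \<and>
           (\<forall>j<N. AE z in circle. g_new z $$ (0, j) = g z $$ (0, j)) \<and>
           (\<forall>i \<in> {1..<N}. \<forall>j<N. AE z in circle. g_new z $$ (i, j) = cuntz_S_adj N j (f i) z) \<and>
           (\<forall>h :: nat \<Rightarrow> complex \<Rightarrow> complex.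
              (\<forall>i \<in> {1..<N}. h i \<in> Linf circle) \<and>
              (\<forall>i \<in> {1..<N}. \<forall>j<N. AE z in circle. g_new z $$ (i, j) = cuntz_S_adj N j (h i) z) \<longrightarrow>
              (\<forall>i \<in> {1..<N}. AE z in circle. h i z = f i z))"
proof -
  have N: "N > 0" using assms(1) by simp
  define f where "f i w = (\<Sum>k<N. cuntz_S N k (\<lambda>z. g_new z $$ (i, k)) w)" for i w
  have adj: "AE z in circle. g_new z $$ (i, j) = cuntz_S_adj N j (f i) z" if "j < N" for i j
  proof (rule AE_I2)
    fix z assume "z \<in> space circle"
    then have "norm z = 1" by (simp add: space_circle)
    from cuntz_S_adj_sum_cuntz_S[OF that this, of "\<lambda>k z. g_new z $$ (i, k)"]
    show "g_new z $$ (i, j) = cuntz_S_adj N j (f i) z" by (simp add: f_def[abs_def])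
  qed
  show ?thesis
  proof (intro exI[of _ f] conjI ballI allI impI)
    fix i assume "i \<in> {1..<N}"
    then show "f i \<in> Linf circle"
      unfolding f_def[abs_def] using assms(4)
      by (intro Linf_sum cuntz_S_Linf N) (auto simp: SL_Linf_def)
  next
    fix j assume j: "j < N"
    show "AE z in circle. g_new z $$ (0, j) = g z $$ (0, j)"
      using assms(5) AE_space
    proof eventually_elim
      case (elim z)
      then have "g_new z \<in> carrier_mat N N"
        using assms(4) by (auto simp: SL_Linf_def space_circle)
      then show ?case using elim(1) j by (simp only: lower_factor_mult_row_0)
    qed
  next
    fix i j assume "j < N"
    then show "AE z in circle. g_new z $$ (i, j) = cuntz_S_adj N j (f i) z" by (rule adj)
  next
    fix h :: "nat \<Rightarrow> complex \<Rightarrow> complex" and i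
    assume h: "(\<forall>i \<in> {1..<N}. h i \<in> Linf circle) \<and>
      (\<forall>i \<in> {1..<N}. \<forall>j<N. AE z in circle. g_new z $$ (i, j) = cuntz_S_adj N j (h i) z)"
      and i: "i \<in> {1..<N}"
    show "AE z in circle. h i z = f i z"
    proof (rule AE_eq_if_cuntz_S_adj_eq[OF N])
      fix j assume j: "j < N"
      have "AE z in circle. g_new z $$ (i, j) = cuntz_S_adj N j (h i) z" using h i j by blast
      then show "AE z in circle. cuntz_S_adj N j (h i) z = cuntz_S_adj N j (f i) z"
        using adj[OF j, of i] by eventually_elim simp
    qed
  qed
qed

end
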